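(* Let $\mathbb K$ be a field of characteristic $0$ and let $(\mathfrak m,[\,,],\{\,,\,,\},\alpha)$ be a Hom-Lie-Yamaguti algebra over $\mathbb K$ with binary operation $[\,,]$, ternary operation $\{\,,\,,\}$ and twisting map $\alpha$. Suppose that $$\{x,y,z\}=-J_{\alpha}(x,y,z)+2[[x,y],\alpha(z)]\qquad\text{for all }x,y,z\in\mathfrak m,$$ where $J_{\alpha}(x,y,z):=[[x,y],\alpha(z)]+[[y,z],\alpha(x)]+[[z,x],\alpha(y)]$. Then $(\mathfrak m,[\,,],\alpha)$ is a Hom-Malcev algebra.
   Context: A Hom-Lie-Yamaguti algebra (Hom-LY algebra) is a quadruple $(L,*,\{\,,\,,\},\alpha)$ in which $L$ is a $\mathbb K$-vector space, $*$ is a bilinear binary operation on $L$, $\{\,,\,,\}$ is a trilinear ternary operation on $L$, and $\alpha:L\to L$ is a linear map, such that for all $u,v,w,x,y,z\in L$ (with $\sigma$ denoting the sum over cyclic permutations of $x,y,z$): (B1) $\alpha(x*y)=\alpha(x)*\alpha(y)$; (B2) $\alpha(\{x,y,z\})=\{\alpha(x),\alpha(y),\alpha(z)\}$; (B3) $x*y=-y*x$; (B4) $\{x,y,z\}=-\{y,x,z\}$; (B5) $\sigma[(x*y)*\alpha(z)+\{x,y,z\}]=0$; (B6) $\sigma[\{x*y,\alpha(z),\alpha(u)\}+\{z*y,\alpha(x),\alpha(u)\}]=0$; (B7) $\{\alpha(x),\alpha(y),u*v\}=\{x,y,u\}*\alpha^{2}(v)+\alpha^{2}(u)*\{x,y,v\}$;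 (B8) $\{\alpha^{2}(x),\alpha^{2}(y),\{\alpha^{2}(u),\alpha^{2}(v),w\}\}=\{\{x,y,\alpha^{2}(u)\},\alpha^{4}(v),\alpha^{2}(w)\}+\{\alpha^{4}(u),\{x,y,\alpha^{2}(v)\},\alpha^{2}(w)\}+\{\alpha^{4}(u),\alpha^{4}(v),\{x,y,w\}\}$. In the claim the binary operation $*$ is denoted $[\,,]$. A Hom-Malcev algebra is a (multiplicative) Hom-algebra $(A,[\,,],\alpha)$, i.e. a $\mathbb K$-vector space $A$ with a bilinear operation $[\,,]$ and a linear map $\alpha:A\to A$ satisfying $\alpha([x,y])=[\alpha(x),\alpha(y)]$, such that $[\,,]$ is skew-symmetric and the Hom-Malcev identity $$J_{\alpha}(\alpha(x),\alpha(y),[x,z])=[J_{\alpha}(x,y,z),\alpha^{2}(x)]$$ holds for all $x,y,z\in A$, where $J_{\alpha}(x,y,z)=[[x,y],\alpha(z)]+[[y,z],\alpha(x)]+[[z,x],\alpha(y)]$. *)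

theory Defs
  imports Complex_Main
begin

definition cyc_sum :: "('a \<Rightarrow> 'a \<Rightarrow> 'a \<Rightarrow> 'b::ab_group_add) \<Rightarrow> 'a \<Rightarrow> 'a \<Rightarrow> 'a \<Rightarrow> 'b" where
  "cyc_sum f x y z = f x y z + f y z x + f z x y"

definition hom_jacobian ::
    "('a \<Rightarrow> 'a \<Rightarrow> 'a::ab_group_add) \<Rightarrow> ('a \<Rightarrow> 'a) \<Rightarrow> 'a \<Rightarrow> 'a \<Rightarrow> 'a \<Rightarrow> 'a" where
  "hom_jacobian br \<alpha> x y z = br (br x y) (\<alpha> z) + br (br y z) (\<alpha> x) + br (br z x) (\<alpha> y)"

text \<open>The algebras below live on a whole type \<open>'a\<close>, made into a vector space over an
  arbitrary field \<open>'k\<close> by \<open>scale\<close>; bilinearity and trilinearity mean linearity in each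
  argument separately.\<close>

locale multiplicative_hom_algebra = vector_space scale
  for scale :: "'k::field \<Rightarrow> 'a::ab_group_add \<Rightarrow> 'a" +
  fixes br :: "'a \<Rightarrow> 'a \<Rightarrow> 'a"
    and \<alpha> :: "'a \<Rightarrow> 'a"
  assumes linear_br_left: "Vector_Spaces.linear scale scale (\<lambda>x. br x y)"
    and linear_br_right: "Vector_Spaces.linear scale scale (\<lambda>y. br x y)"
    and linear_twist: "Vector_Spaces.linear scale scale \<alpha>"
    and twist_br: "\<alpha> (br x y) = br (\<alpha> x) (\<alpha> y)"

locale hom_malcev_algebra = multiplicative_hom_algebra scale br \<alpha>
  for scale :: "'k::field \<Rightarrow> 'a::ab_group_add \<Rightarrow> 'a"
    and br :: "'a \<Rightarrow> 'a \<Rightarrow> 'a"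
    and \<alpha> :: "'a \<Rightarrow> 'a" +
  assumes br_skew: "br x y = - br y x"
    and hom_malcev:
      "hom_jacobian br \<alpha> (\<alpha> x) (\<alpha> y) (br x z) = br (hom_jacobian br \<alpha> x y z) ((\<alpha> ^^ 2) x)"

text \<open>In \<open>B6\<close> the two families cancel as soon as \<open>B3\<close> and linearity in the first
  argument of \<open>tri\<close> hold; the axiom is nevertheless kept in this form.\<close>

locale hom_lie_yamaguti_algebra = multiplicative_hom_algebra scale br \<alpha>
  for scale :: "'k::field \<Rightarrow> 'a::ab_group_add \<Rightarrow> 'a"
    and br :: "'a \<Rightarrow> 'a \<Rightarrow> 'a"
    and tri :: "'a \<Rightarrow> 'a \<Rightarrow> 'a \<Rightarrow> 'a"
    and \<alpha> :: "'a \<Rightarrow> 'a" +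
  assumes linear_tri_1: "Vector_Spaces.linear scale scale (\<lambda>x. tri x y z)"
    and linear_tri_2: "Vector_Spaces.linear scale scale (\<lambda>y. tri x y z)"
    and linear_tri_3: "Vector_Spaces.linear scale scale (\<lambda>z. tri x y z)"
    and B2: "\<alpha> (tri x y z) = tri (\<alpha> x) (\<alpha> y) (\<alpha> z)"
    and B3: "br x y = - br y x"
    and B4: "tri x y z = - tri y x z"
    and B5: "cyc_sum (\<lambda>x y z. br (br x y) (\<alpha> z) + tri x y z) x y z = 0"
    and B6: "cyc_sum (\<lambda>x y z. tri (br x y) (\<alpha> z) (\<alpha> u) + tri (br z y) (\<alpha> x) (\<alpha> u)) x y z = 0"
    and B7: "tri (\<alpha> x) (\<alpha> y) (br u v)
        = br (tri x y u) ((\<alpha> ^^ 2) v) + br ((\<alpha> ^^ 2) u) (tri x y v)"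
    and B8: "tri ((\<alpha> ^^ 2) x) ((\<alpha> ^^ 2) y) (tri ((\<alpha> ^^ 2) u) ((\<alpha> ^^ 2) v) w)
        = tri (tri x y ((\<alpha> ^^ 2) u)) ((\<alpha> ^^ 4) v) ((\<alpha> ^^ 2) w)
        + tri ((\<alpha> ^^ 4) u) (tri x y ((\<alpha> ^^ 2) v)) ((\<alpha> ^^ 2) w)
        + tri ((\<alpha> ^^ 4) u) ((\<alpha> ^^ 4) v) (tri x y w)"

end

theory Submission
  imports Defs
begin

text \<open>
  The proof rests on axiom \<open>B7\<close>, which says that \<open>tri x y\<close> is a (twisted) derivation of the
  binary bracket. With \<open>tri = - J + 2[[x, y], \<alpha> z]\<close>, the second summand is twice the
  left multiplication by \<open>[x, y]\<close>, which fails to be a derivation exactly by the Jacobian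
  \<open>J([x, y], \<alpha> u, \<alpha> v)\<close>. So \<open>B7\<close> becomes an identity about Jacobians alone
  (\<open>jacobian_derivation\<close>):
  \<open>J(\<alpha> x, \<alpha> y, [u, v]) = [J(x, y, u), \<alpha>\<^sup>2 v] + [\<alpha>\<^sup>2 u, J(x, y, v)] - 2 J([x, y], \<alpha> u, \<alpha> v)\<close>.

  Now put \<open>u = x\<close>, \<open>v = z\<close>, and write \<open>M = J(\<alpha> x, \<alpha> y, [x, z])\<close>,
  \<open>N = J(\<alpha> x, \<alpha> z, [x, y])\<close> and \<open>P = [J(x, y, z), \<alpha>\<^sup>2 x]\<close>. As \<open>J\<close> is alternating
  (for \<open>J(x, y, x) = 0\<close> this uses that 2 is invertible), the identity reads \<open>M = - P - 2 N\<close>. Exchanging \<open>y\<close> and \<open>z\<close> swaps \<open>M\<close> and \<open>N\<close> and negates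
  \<open>P\<close>, so \<open>N = P - 2 M\<close>. Eliminating \<open>N\<close> gives \<open>3 M = 3 P\<close>, and \<open>M = P\<close> is the
  Hom-Malcev identity as soon as 3 is invertible.
\<close>

lemma (in vector_space) triple_cancel:
  assumes "(3::'a) \<noteq> 0" and "(x::'b) + x + x = y + y + y"
  shows "x = y"
proof -
  have triple: "scale 3 v = v + v + v" for v
    using scale_left_distrib[of "1 + 1" 1 v] scale_left_distrib[of 1 1 v] by simp
  have "scale 3 x = scale 3 y"
    using assms(2) by (simp add: triple)
  then show ?thesis
    using assms(1) by simp
qed

context multiplicative_hom_algebra
begin

lemma br_add_left: "br (x + y) z = br x z + br y z"
  using linear_br_left[of z] unfolding Vector_Spaces.linear_iff_module_hom by (rule module_hom.add)

lemma br_add_right: "br x (y + z) = br x y + br x z"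
  using linear_br_right[of x] unfolding Vector_Spaces.linear_iff_module_hom by (rule module_hom.add)

lemma br_minus_left: "br (- x) z = - br x z"
  using linear_br_left[of z] unfolding Vector_Spaces.linear_iff_module_hom by (rule module_hom.neg)

lemma br_minus_right: "br x (- y) = - br x y"
  using linear_br_right[of x] unfolding Vector_Spaces.linear_iff_module_hom by (rule module_hom.neg)

lemma br_zero_left: "br 0 z = 0"
  using linear_br_left[of z] unfolding Vector_Spaces.linear_iff_module_hom by (rule module_hom.zero)

lemma hom_jacobian_cyclic: "hom_jacobian br \<alpha> y z x = hom_jacobian br \<alpha> x y z"
  by (simp add: hom_jacobian_def add_ac)

lemma hom_jacobian_swap_right:
  assumes skew: "\<And>x y. br x y = - br y x"
  shows "hom_jacobian br \<alpha> x z y = - hom_jacobian br \<alpha> x y z"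
  using skew[of x z] skew[of z y] skew[of y x]
  by (simp add: hom_jacobian_def br_minus_left)

text \<open>
  In characteristic 2 skew-symmetry does not give \<open>[x, x] = 0\<close>, hence the separate hypothesis.
  It removes the term \<open>[[x, x], \<alpha> y]\<close>; the other two cancel by skew-symmetry.
\<close>

lemma hom_jacobian_repeated:
  assumes skew: "\<And>x y. br x y = - br y x" and "br x x = 0"
  shows "hom_jacobian br \<alpha> x y x = 0"
  using skew[of y x] assms(2) by (simp add: hom_jacobian_def br_minus_left br_zero_left)

text \<open>
  The Jacobian of \<open>[x, y]\<close>, \<open>\<alpha> u\<close>, \<open>\<alpha> v\<close> measures how far left multiplication by
  \<open>[x, y]\<close> is from satisfying the twisted Leibniz rule of \<open>B7\<close>.
\<close>

lemma left_mult_leibniz_defect: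
  assumes skew: "\<And>x y. br x y = - br y x"
  shows "br (br (br x y) (\<alpha> u)) ((\<alpha> ^^ 2) v) + br ((\<alpha> ^^ 2) u) (br (br x y) (\<alpha> v))
    = hom_jacobian br \<alpha> (br x y) (\<alpha> u) (\<alpha> v) + br (br (\<alpha> x) (\<alpha> y)) (\<alpha> (br u v))"
proof -
  have "br (br (\<alpha> v) (br x y)) (\<alpha> (\<alpha> u)) = br (\<alpha> (\<alpha> u)) (br (br x y) (\<alpha> v))"
    using skew[of "br (\<alpha> v) (br x y)" "\<alpha> (\<alpha> u)"] skew[of "\<alpha> v" "br x y"]
    by (simp add: br_minus_right)
  moreover have "br (br (\<alpha> u) (\<alpha> v)) (\<alpha> (br x y)) = - br (br (\<alpha> x) (\<alpha> y)) (\<alpha> (br u v))"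
    using skew[of "br (\<alpha> u) (\<alpha> v)" "\<alpha> (br x y)"] by (simp add: twist_br)
  ultimately show ?thesis
    by (simp add: hom_jacobian_def numeral_2_eq_2)
qed

end

context hom_lie_yamaguti_algebra
begin

text \<open>
  This is \<open>B7\<close> with the ternary operation eliminated: the Leibniz defect of left multiplication
  by \<open>[x, y]\<close> is what remains after the terms \<open>2[[x, y], \<alpha> [u, v]]\<close> cancel.
\<close>

lemma jacobian_derivation:
  assumes tri_eq: "\<And>x y z. tri x y z = - hom_jacobian br \<alpha> x y z + scale 2 (br (br x y) (\<alpha> z))"
  shows "hom_jacobian br \<alpha> (\<alpha> x) (\<alpha> y) (br u v)
    = br (hom_jacobian br \<alpha> x y u) ((\<alpha> ^^ 2) v) + br ((\<alpha> ^^ 2) u) (hom_jacobian br \<alpha> x y v)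
      - (hom_jacobian br \<alpha> (br x y) (\<alpha> u) (\<alpha> v) + hom_jacobian br \<alpha> (br x y) (\<alpha> u) (\<alpha> v))"
    (is "?J = ?A + ?B - (?N + ?N)")
proof -
  let ?l = "br (br (br x y) (\<alpha> u)) ((\<alpha> ^^ 2) v)"
  let ?r = "br ((\<alpha> ^^ 2) u) (br (br x y) (\<alpha> v))"
  let ?c = "br (br (\<alpha> x) (\<alpha> y)) (\<alpha> (br u v))"
  have double: "scale 2 w = w + w" for w
    using scale_left_distrib[of 1 1 w] by simp
  have "- ?J + (?c + ?c) = (- ?A + (?l + ?l)) + (- ?B + (?r + ?r))"
    using B7[of x y u v]
    by (simp only: tri_eq double br_add_left br_add_right br_minus_left br_minus_right)
  also have "\<dots> = - ?A - ?B + ((?l + ?r) + (?l + ?r))"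
    by (simp add: algebra_simps)
  also have "?l + ?r = ?N + ?c"
    by (rule left_mult_leibniz_defect) (rule B3)
  finally show ?thesis
    by (simp add: algebra_simps)
qed

lemma hom_malcev_identity:
  assumes tri_eq: "\<And>x y z. tri x y z = - hom_jacobian br \<alpha> x y z + scale 2 (br (br x y) (\<alpha> z))"
    and two: "(2::'k) \<noteq> 0" and three: "(3::'k) \<noteq> 0"
  shows "hom_jacobian br \<alpha> (\<alpha> x) (\<alpha> y) (br x z) = br (hom_jacobian br \<alpha> x y z) ((\<alpha> ^^ 2) x)"
proof -
  let ?J = "hom_jacobian br \<alpha>"
  define M where "M y z = ?J (\<alpha> x) (\<alpha> y) (br x z)" for y z
  define P where "P y z = br (?J x y z) ((\<alpha> ^^ 2) x)" for y z
  have "scale 2 (br x x) = 0"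
    using B3[of x x] scale_left_distrib[of 1 1 "br x x"] by (simp add: eq_neg_iff_add_eq_0)
  then have "br x x = 0"
    using two by simp
  then have repeated: "?J x y x = 0" for y
    by (intro hom_jacobian_repeated) (rule B3)
  have relation: "M y z = - P y z - (M z y + M z y)" for y z
  proof -
    have "br ((\<alpha> ^^ 2) x) (?J x y z) = - P y z"
      unfolding P_def by (rule B3)
    moreover have "?J (br x y) (\<alpha> x) (\<alpha> z) = M z y"
      unfolding M_def using hom_jacobian_cyclic[of "\<alpha> x" "\<alpha> z" "br x y"] by simp
    ultimately show ?thesis
      using jacobian_derivation[OF tri_eq, of x y x z] repeated[of y]
      by (simp add: M_def br_zero_left)
  qed
  have "P z y = - P y z"
    unfolding P_def using hom_jacobian_swap_right[OF B3, of x z y] by (simp add: br_minus_left)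
  then have "M y z + M y z + M y z = P y z + P y z + P y z"
    using relation[of y z] relation[of z y] by (simp add: algebra_simps)
  then have "M y z = P y z"
    by (rule triple_cancel[OF three])
  then show ?thesis
    by (simp add: M_def P_def)
qed

end

theorem proposition4p1:
  fixes scale :: "'k::field_char_0 \<Rightarrow> 'm::ab_group_add \<Rightarrow> 'm"
    and br :: "'m \<Rightarrow> 'm \<Rightarrow> 'm"
    and tri :: "'m \<Rightarrow> 'm \<Rightarrow> 'm \<Rightarrow> 'm"
    and \<alpha> :: "'m \<Rightarrow> 'm"
  assumes "hom_lie_yamaguti_algebra scale br tri \<alpha>"
    and "\<And>x y z. tri x y z = - hom_jacobian br \<alpha> x y z + scale 2 (br (br x y) (\<alpha> z))"
  shows "hom_malcev_algebra scale br \<alpha>"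
proof -
  interpret hom_lie_yamaguti_algebra scale br tri \<alpha>
    by (rule assms(1))
  show ?thesis
  proof
    show "br x y = - br y x" for x y
      by (rule B3)
    show "hom_jacobian br \<alpha> (\<alpha> x) (\<alpha> y) (br x z) = br (hom_jacobian br \<alpha> x y z) ((\<alpha> ^^ 2) x)"
      for x y z
      by (rule hom_malcev_identity[OF assms(2)]) simp_all
  qed
qed

end
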